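(* Let $\mathcal F$ be a non-empty fraction without replicates of the complex coded full factorial design $\mathcal D$. The following statements are equivalent: (1) $\mathcal F$ is regular, i.e. there exist a subgroup $\mathcal L$ of $L$ and a group homomorphism $e:\mathcal L\to\Omega_n$ (so $e([\alpha+\beta])=e(\alpha)e(\beta)$ for all $\alpha,\beta\in\mathcal L$) such that $\mathcal F=\{\zeta\in\mathcal D: X^\alpha(\zeta)=e(\alpha)\text{ for all }\alpha\in\mathcal L\}$. (2) The indicator function $F$ of $\mathcal F$ has the form $$F(\zeta)=\frac1l\sum_{\alpha\in\mathcal L}\overline{e(\alpha)}\,X^\alpha(\zeta),\qquad\zeta\in\mathcal D,$$ where $\mathcal L$ is a subset of $L$ containing $(0,\dots,0)$, $l=\#\mathcal L$, and $e:\mathcal L\to\Omega_n$ is a mapping. (3) For each $\alpha,\beta\in L$, the parametric functions represented on $\mathcal F$ by the terms $X^\alpha$ and $X^\beta$ are either orthogonal or totally confounded.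
   Context: Let $m\ge 1$, let $n_1,\dots,n_m$ be positive integers and $n=\mathrm{lcm}\{n_1,\dots,n_m\}$. For a positive integer $k$, $\Omega_k\subset\mathbb C$ is the multiplicative group of $k$-th roots of unity. The full factorial design is $\mathcal D=\Omega_{n_1}\times\cdots\times\Omega_{n_m}$ and the exponent set is the additive group $L=\mathbb Z_{n_1}\times\cdots\times\mathbb Z_{n_m}$, with elements $\alpha=(\alpha_1,\dots,\alpha_m)$, $0\le\alpha_j\le n_j-1$; $[\alpha+\beta]$ denotes the sum in $L$ (componentwise mod $n_j$). For $\alpha\in L$, $X^\alpha:\mathcal D\to\mathbb C$ is $X^\alpha(\zeta_1,\dots,\zeta_m)=\zeta_1^{\alpha_1}\cdots\zeta_m^{\alpha_m}$. A fraction without replicates is a subset $\mathcal F\subseteq\mathcal D$; its indicator function $F:\mathcal D\to\{0,1\}$ equals $1$ on $\mathcal F$ and $0$ on $\mathcal D\setminus\mathcal F$. The terms $X^\alpha$ and $X^\beta$ are orthogonal on $\mathcal F$ if $\frac1{\#\mathcal F}\sum_{\zeta\in\mathcal F}X^\alpha(\zeta)\overline{X^\beta(\zeta)}=0$; they are totally confounded on $\mathcal F$ if there is a constant $c\in\mathbb C$ with $X^\alpha(\zeta)=c\,X^\beta(\zeta)$ for all $\zeta\in\mathcal F$. *)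

theory Defs
  imports Complex_Main "HOL-Library.Indicator_Function" "HOL-Algebra.Product_Groups"
begin

text \<open>
  A design with \<open>m\<close> factors, the \<open>j\<close>-th of which has \<open>N j\<close> levels for \<open>j \<in> {1..m}\<close>, is given by
  \<open>m :: nat\<close> and \<open>N :: nat \<Rightarrow> nat\<close>.  Tuples are functions on \<open>{1..m}\<close>, extended by \<open>undefined\<close>.
\<close>

definition unity_roots :: "nat \<Rightarrow> complex monoid" where
  "unity_roots k = \<lparr>carrier = {z. z ^ k = 1}, monoid.mult = (*), one = 1\<rparr>"

definition full_design :: "nat \<Rightarrow> (nat \<Rightarrow> nat) \<Rightarrow> (nat \<Rightarrow> complex) set" where
  "full_design m N = (\<Pi>\<^sub>E j\<in>{1..m}. carrier (unity_roots (N j)))"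

definition exponent_group :: "nat \<Rightarrow> (nat \<Rightarrow> nat) \<Rightarrow> (nat \<Rightarrow> int) monoid" where
  "exponent_group m N = product_group {1..m} (\<lambda>j. integer_mod_group (N j))"

definition level_lcm :: "nat \<Rightarrow> (nat \<Rightarrow> nat) \<Rightarrow> nat" where
  "level_lcm m N = Lcm (N ` {1..m})"

text \<open>The exponents in \<open>exponent_group m N\<close> are the representatives \<open>0 \<le> \<alpha> j < int (N j)\<close>, so the
  integer powers below are ordinary powers.\<close>

definition term_fun :: "nat \<Rightarrow> (nat \<Rightarrow> int) \<Rightarrow> (nat \<Rightarrow> complex) \<Rightarrow> complex" where
  "term_fun m \<alpha> \<zeta> = (\<Prod>j = 1..m. \<zeta> j powi \<alpha> j)"

definition orthogonal_on ::
  "nat \<Rightarrow> (nat \<Rightarrow> complex) set \<Rightarrow> (nat \<Rightarrow> int) \<Rightarrow> (nat \<Rightarrow> int) \<Rightarrow> bool" where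
  "orthogonal_on m \<F> \<alpha> \<beta> \<longleftrightarrow>
     1 / of_nat (card \<F>) * (\<Sum>\<zeta>\<in>\<F>. term_fun m \<alpha> \<zeta> * cnj (term_fun m \<beta> \<zeta>)) = 0"

definition totally_confounded_on ::
  "nat \<Rightarrow> (nat \<Rightarrow> complex) set \<Rightarrow> (nat \<Rightarrow> int) \<Rightarrow> (nat \<Rightarrow> int) \<Rightarrow> bool" where
  "totally_confounded_on m \<F> \<alpha> \<beta> \<longleftrightarrow>
     (\<exists>c. \<forall>\<zeta>\<in>\<F>. term_fun m \<alpha> \<zeta> = c * term_fun m \<beta> \<zeta>)"

definition regular_fraction :: "nat \<Rightarrow> (nat \<Rightarrow> nat) \<Rightarrow> (nat \<Rightarrow> complex) set \<Rightarrow> bool" where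
  "regular_fraction m N \<F> \<longleftrightarrow>
     (\<exists>\<L> e. subgroup \<L> (exponent_group m N) \<and>
            e \<in> hom ((exponent_group m N)\<lparr>carrier := \<L>\<rparr>) (unity_roots (level_lcm m N)) \<and>
            \<F> = {\<zeta> \<in> full_design m N. \<forall>\<alpha>\<in>\<L>. term_fun m \<alpha> \<zeta> = e \<alpha>})"

end

theory Submission
  imports Defs
begin

text \<open>
  The terms \<open>X\<^sup>\<alpha>\<close> are the characters of the finite abelian group \<open>\<D>\<close>, and evaluation at a point of
  \<open>\<D>\<close> is a character of \<open>L\<close>.  Everything rests on one fact: the values of a nontrivial character of
  a finite group sum to zero (\<open>sum_nontrivial_character\<close>).  It is applied to three groups: to a
  subgroup of \<open>L\<close>, to \<open>\<D>\<close>, and to \<open>L\<close>.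

  The subgroup demanded by regularity costs nothing.  If \<open>\<F>\<close> is cut out of \<open>\<D>\<close> by any family of
  equations \<open>X\<^sup>\<alpha> = e \<alpha>\<close>, then the exponents of all terms that are constant on \<open>\<F>\<close> form a subgroup of
  \<open>L\<close>, the constant value is a homomorphism, and these equations cut out \<open>\<F>\<close> as well
  (\<open>regular_fraction_if_equations\<close>).  So each of the other two conditions only has to produce defining
  equations.

  \<^item> If \<open>\<F>\<close> is regular with subgroup \<open>\<L>\<close>, then for fixed \<open>\<zeta>\<close> the map \<open>\<alpha> \<mapsto> cnj (e \<alpha>) X\<^sup>\<alpha>(\<zeta>)\<close> is a
    character of \<open>\<L>\<close>, trivial exactly when \<open>\<zeta> \<in> \<F>\<close>; its mean is therefore the indicator function.

  \<^item> If the indicator function is the mean of the unimodular numbers \<open>cnj (e \<alpha>) X\<^sup>\<alpha>(\<zeta>)\<close>, it can be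
    \<open>1\<close> only when all of them are \<open>1\<close>.  Hence the equations \<open>X\<^sup>\<alpha> = e \<alpha>\<close> define \<open>\<F>\<close>.

  \<^item> If \<open>\<F>\<close> is regular and \<open>\<gamma> = [\<alpha> - \<beta>]\<close>, then \<open>X\<^sup>\<gamma>\<close> is constant on \<open>\<F>\<close> when \<open>\<gamma> \<in> \<L>\<close>, so that
    \<open>X\<^sup>\<alpha>\<close> and \<open>X\<^sup>\<beta>\<close> are totally confounded.  When \<open>\<gamma> \<notin> \<L>\<close>, expanding the indicator function turns the
    sum of \<open>X\<^sup>\<gamma>\<close> over \<open>\<F>\<close> into a combination of sums over \<open>\<D>\<close> of the terms with exponent \<open>[\<delta> + \<gamma>]\<close>
    for \<open>\<delta> \<in> \<L>\<close>.  Such an exponent is never zero, as \<open>\<gamma>\<close> would then be the inverse of \<open>\<delta>\<close> and lie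
    in \<open>\<L>\<close>; so all these sums vanish and the two terms are orthogonal.

  \<^item> Conversely, confront every \<open>\<alpha>\<close> with the exponent \<open>0\<close>: each term is constant on \<open>\<F>\<close> or sums
    to zero over \<open>\<F>\<close>.  If \<open>\<zeta>\<close> satisfies the equations given by all constant terms, then the sum of
    \<open>X\<^sup>\<alpha>(\<eta>) cnj (X\<^sup>\<alpha>(\<zeta>))\<close> over \<open>\<alpha> \<in> L\<close> and \<open>\<eta> \<in> \<F>\<close> is a positive integer, whereas it would be zero
    if \<open>\<zeta>\<close> differed from every \<open>\<eta> \<in> \<F>\<close>.
\<close>

section \<open>Characters of groups\<close>

text \<open>Translation by an element \<open>g\<close> permutes the group and multiplies the sum by \<open>\<chi> g \<noteq> 1\<close>.\<close>

lemma (in group) sum_nontrivial_character: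
  fixes \<chi> :: "'a \<Rightarrow> 'c :: idom"
  assumes mult: "\<And>x y. x \<in> carrier G \<Longrightarrow> y \<in> carrier G \<Longrightarrow> \<chi> (x \<otimes> y) = \<chi> x * \<chi> y"
    and g: "g \<in> carrier G" "\<chi> g \<noteq> 1"
  shows "(\<Sum>x\<in>carrier G. \<chi> x) = 0"
proof -
  have "bij_betw (\<lambda>x. g \<otimes> x) (carrier G) (carrier G)"
    using g(1) by (simp add: bij_betw_def inj_on_cmult surj_const_mult)
  then have "(\<Sum>x\<in>carrier G. \<chi> x) = (\<Sum>x\<in>carrier G. \<chi> (g \<otimes> x))"
    by (rule sum.reindex_bij_betw [symmetric])
  also have "\<dots> = \<chi> g * (\<Sum>x\<in>carrier G. \<chi> x)"
    using g(1) by (simp add: mult sum_distrib_left)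
  finally have "(1 - \<chi> g) * (\<Sum>x\<in>carrier G. \<chi> x) = 0"
    by (simp add: algebra_simps)
  then show ?thesis
    using g(2) by simp
qed

text \<open>The real parts of the summands are at most \<open>1\<close>, so none of them can fall short.\<close>

lemma sum_unimodular_eq_card_imp_eq_1:
  fixes u :: "'a \<Rightarrow> complex"
  assumes "finite A" and norm: "\<And>a. a \<in> A \<Longrightarrow> cmod (u a) = 1"
    and sum: "(\<Sum>a\<in>A. u a) = of_nat (card A)" and "a \<in> A"
  shows "u a = 1"
proof -
  have "(\<Sum>a\<in>A. 1 - Re (u a)) = 0"
    using arg_cong [OF sum, of Re] by (simp add: sum_subtractf)
  moreover have "0 \<le> 1 - Re (u a)" if "a \<in> A" for a
    using complex_Re_le_cmod [of "u a"] norm [OF that] by simp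
  ultimately have "1 - Re (u a) = 0"
    using \<open>finite A\<close> \<open>a \<in> A\<close> by (simp add: sum_nonneg_eq_0_iff)
  moreover have "(Re (u a))\<^sup>2 + (Im (u a))\<^sup>2 = 1"
    using norm [OF \<open>a \<in> A\<close>] by (simp flip: cmod_power2)
  ultimately show ?thesis
    by (simp add: complex_eq_iff)
qed

lemma group_unity_roots:
  assumes "k > 0"
  shows "group (unity_roots k)"
proof (rule groupI)
  fix z assume "z \<in> carrier (unity_roots k)"
  then have "z \<noteq> 0" "z ^ k = 1"
    using assms by (auto simp: unity_roots_def power_0_left)
  then show "\<exists>w\<in>carrier (unity_roots k). w \<otimes>\<^bsub>unity_roots k\<^esub> z = \<one>\<^bsub>unity_roots k\<^esub>"
    by (intro bexI [of _ "inverse z"]) (auto simp: unity_roots_def power_inverse)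
qed (auto simp: unity_roots_def power_mult_distrib)

lemma unity_root_powi_mod:
  fixes z :: complex
  assumes "z ^ k = 1" "k > 0"
  shows "z powi (a mod int k) = z powi a"
proof -
  have "z \<noteq> 0"
    using assms by (auto simp: power_0_left)
  have "z powi a = z powi (int k * (a div int k) + a mod int k)"
    by simp
  also have "\<dots> = (z ^ k) powi (a div int k) * z powi (a mod int k)"
    using \<open>z \<noteq> 0\<close> by (simp only: power_int_add power_int_power simp_thms)
  finally show ?thesis
    using assms by simp
qed

lemma cnj_eq_inverse_if_unimodular: "cmod z = 1 \<Longrightarrow> cnj z = inverse z"
  using complex_norm_square [of z] by (simp add: inverse_unique)

lemma unimodular_mult_cnj_eq_1_iff:
  assumes "cmod z = 1"
  shows "w * cnj z = 1 \<longleftrightarrow> w = z" and "cnj z * w = 1 \<longleftrightarrow> w = z"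
proof -
  have "z \<noteq> 0"
    using assms by auto
  then show "w * cnj z = 1 \<longleftrightarrow> w = z" "cnj z * w = 1 \<longleftrightarrow> w = z"
    by (auto simp: cnj_eq_inverse_if_unimodular [OF assms] field_simps)
qed

section \<open>Terms as characters of the design and of the exponent group\<close>

locale factorial_design =
  fixes m :: nat and N :: "nat \<Rightarrow> nat"
  assumes levels_pos: "\<And>j. j \<in> {1..m} \<Longrightarrow> N j > 0"
begin

abbreviation "L \<equiv> exponent_group m N"
abbreviation "\<D> \<equiv> full_design m N"
abbreviation "X \<equiv> term_fun m"

definition design_group :: "(nat \<Rightarrow> complex) monoid" where
  "design_group = product_group {1..m} (\<lambda>j. unity_roots (N j))"

lemma carrier_design_group: "carrier design_group = \<D>"
  by (simp add: design_group_def full_design_def)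

lemma group_design_group: "group design_group"
  unfolding design_group_def using levels_pos by (intro product_group group_unity_roots)

lemma group_L: "group L"
  by (simp add: exponent_group_def)

sublocale L: group L
  by (rule group_L)

lemma finite_L: "finite (carrier L)"
  using levels_pos
  by (auto simp: exponent_group_def carrier_integer_mod_group intro!: finite_PiE)

lemma finite_design: "finite \<D>"
  unfolding full_design_def
proof (rule finite_PiE)
  show "finite (carrier (unity_roots (N j)))" if "j \<in> {1..m}" for j
    using levels_pos [OF that] by (simp add: unity_roots_def finite_roots_unity Suc_leI)
qed simp

lemma design_coordinate:
  assumes "\<zeta> \<in> \<D>" "j \<in> {1..m}"
  shows "\<zeta> j ^ N j = 1" "\<zeta> j \<noteq> 0"
proof -
  show "\<zeta> j ^ N j = 1"
    using PiE_mem assms by (fastforce simp: full_design_def unity_roots_def)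
  then show "\<zeta> j \<noteq> 0"
    using levels_pos [OF assms(2)] by (auto simp: power_0_left)
qed

lemma X_one: "X \<one>\<^bsub>L\<^esub> \<zeta> = 1"
  by (simp add: term_fun_def exponent_group_def)

lemma X_mult:
  assumes "\<zeta> \<in> \<D>"
  shows "X (\<alpha> \<otimes>\<^bsub>L\<^esub> \<beta>) \<zeta> = X \<alpha> \<zeta> * X \<beta> \<zeta>"
proof -
  have "\<zeta> j powi (\<alpha> \<otimes>\<^bsub>L\<^esub> \<beta>) j = \<zeta> j powi \<alpha> j * \<zeta> j powi \<beta> j" if "j \<in> {1..m}" for j
    using that design_coordinate [OF assms that] levels_pos [OF that]
    by (simp add: exponent_group_def unity_root_powi_mod power_int_add)
  then show ?thesis
    by (simp add: term_fun_def prod.distrib)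
qed

lemma X_mult_points: "X \<alpha> (\<zeta> \<otimes>\<^bsub>design_group\<^esub> \<eta>) = X \<alpha> \<zeta> * X \<alpha> \<eta>"
proof -
  have "(\<zeta> \<otimes>\<^bsub>design_group\<^esub> \<eta>) j powi \<alpha> j = \<zeta> j powi \<alpha> j * \<eta> j powi \<alpha> j"
    if "j \<in> {1..m}" for j
    using that by (simp add: design_group_def unity_roots_def power_int_mult_distrib)
  then show ?thesis
    by (simp add: term_fun_def prod.distrib)
qed

lemma level_lcm_pos: "level_lcm m N > 0"
proof -
  have "0 \<notin> N ` {1..m}"
    using levels_pos by force
  then have "level_lcm m N \<noteq> 0"
    unfolding level_lcm_def by (subst Lcm_0_iff) simp_all
  then show ?thesis
    by simp
qed

lemma X_unity_root:
  assumes "\<zeta> \<in> \<D>"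
  shows "X \<alpha> \<zeta> ^ level_lcm m N = 1"
proof -
  have "(\<zeta> j powi \<alpha> j) ^ level_lcm m N = 1" if "j \<in> {1..m}" for j
  proof -
    have "N j dvd level_lcm m N"
      using that by (auto simp: level_lcm_def)
    then have "\<zeta> j ^ level_lcm m N = 1"
      using design_coordinate [OF assms that] by (auto simp: power_mult)
    moreover have "(\<zeta> j powi \<alpha> j) ^ level_lcm m N = (\<zeta> j ^ level_lcm m N) powi \<alpha> j"
      by (simp only: power_int_power power_int_power' mult.commute)
    ultimately show ?thesis
      by simp
  qed
  then show ?thesis
    by (simp add: term_fun_def prod_power_distrib)
qed

lemma norm_X: "\<zeta> \<in> \<D> \<Longrightarrow> cmod (X \<alpha> \<zeta>) = 1"
  using power_eq_1_iff [OF X_unity_root] level_lcm_pos by auto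

lemma X_diff:
  assumes "\<zeta> \<in> \<D>" "\<alpha> \<in> carrier L" "\<beta> \<in> carrier L"
  shows "X (\<alpha> \<otimes>\<^bsub>L\<^esub> inv\<^bsub>L\<^esub> \<beta>) \<zeta> = X \<alpha> \<zeta> * cnj (X \<beta> \<zeta>)"
proof -
  have "X (\<alpha> \<otimes>\<^bsub>L\<^esub> inv\<^bsub>L\<^esub> \<beta>) \<zeta> * X \<beta> \<zeta> = X (\<alpha> \<otimes>\<^bsub>L\<^esub> inv\<^bsub>L\<^esub> \<beta> \<otimes>\<^bsub>L\<^esub> \<beta>) \<zeta>"
    by (simp only: X_mult [OF assms(1)])
  also have "\<dots> = X \<alpha> \<zeta>"
    using assms by (simp add: L.m_assoc)
  finally have "X (\<alpha> \<otimes>\<^bsub>L\<^esub> inv\<^bsub>L\<^esub> \<beta>) \<zeta> * X \<beta> \<zeta> = X \<alpha> \<zeta>" .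
  moreover have "X \<beta> \<zeta> \<noteq> 0"
    using norm_X [OF assms(1), of \<beta>] by auto
  ultimately show ?thesis
    using norm_X [OF assms(1), of \<beta>] by (simp add: cnj_eq_inverse_if_unimodular field_simps)
qed

text \<open>A nonzero exponent \<open>\<delta>\<close> has some \<open>0 < \<delta> j < N j\<close>, and the point with a primitive \<open>N j\<close>-th root
  of unity at \<open>j\<close> and \<open>1\<close> elsewhere witnesses that \<open>X\<^sup>\<delta>\<close> is a nontrivial character of the design.\<close>

lemma sum_X_design:
  assumes "\<delta> \<in> carrier L" "\<delta> \<noteq> \<one>\<^bsub>L\<^esub>"
  shows "(\<Sum>\<zeta>\<in>\<D>. X \<delta> \<zeta>) = 0"
proof -
  have "\<delta> \<in> extensional {1..m}"
    using assms(1) by (simp add: exponent_group_def PiE_iff)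
  then have "\<delta> = \<one>\<^bsub>L\<^esub>" if "\<forall>j\<in>{1..m}. \<delta> j = 0"
    using that unfolding exponent_group_def
    by (intro extensionalityI [of _ "{1..m}"]) (simp_all del: One_nat_def)
  then obtain j where j: "j \<in> {1..m}" "\<delta> j \<noteq> 0"
    using assms(2) by blast
  have "\<delta> j \<in> carrier (integer_mod_group (N j))"
    using assms(1) j(1) by (simp add: exponent_group_def PiE_iff)
  then have range: "0 \<le> \<delta> j" "\<delta> j < int (N j)"
    using levels_pos [OF j(1)] by (simp_all add: carrier_integer_mod_group)
  define \<omega> where "\<omega> = cis (2 * pi / real (N j))"
  define \<zeta> where "\<zeta> = (\<lambda>i\<in>{1..m}. if i = j then \<omega> else 1)"
  have "\<omega> ^ N j = 1"
    using levels_pos [OF j(1)] by (simp add: \<omega>_def DeMoivre)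
  then have \<zeta>: "\<zeta> \<in> \<D>"
    by (auto simp: \<zeta>_def full_design_def unity_roots_def)
  have "X \<delta> \<zeta> = (\<Prod>i=1..m. if i = j then \<omega> powi \<delta> j else 1)"
    unfolding term_fun_def by (rule prod.cong) (auto simp: \<zeta>_def)
  also have "\<dots> = \<omega> ^ nat (\<delta> j)"
    using j(1) range(1) by (simp add: power_int_nonneg_exp)
  also have "\<dots> \<noteq> 1"
  proof
    assume "\<omega> ^ nat (\<delta> j) = 1"
    then have "cis (2 * pi * real (nat (\<delta> j)) / real (N j)) = cis (2 * pi * real 0 / real (N j))"
      by (simp add: \<omega>_def DeMoivre mult_ac)
    moreover have inj: "inj_on (\<lambda>k. cis (2 * pi * real k / real (N j))) {..<N j}"
      using bij_betw_roots_unity [OF levels_pos [OF j(1)]] by (simp add: bij_betw_def)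
    ultimately have "nat (\<delta> j) = 0"
      using inj_onD [OF inj, of "nat (\<delta> j)" 0] range levels_pos [OF j(1)] by auto
    then show False
      using j(2) range(1) by simp
  qed
  finally have "X \<delta> \<zeta> \<noteq> 1" .
  then show ?thesis
    using \<zeta> unfolding carrier_design_group [symmetric]
    by (intro group.sum_nontrivial_character [OF group_design_group, of "X \<delta>" \<zeta>] X_mult_points)
qed

text \<open>Two different points differ in some coordinate \<open>j\<close>, hence are separated by the term whose
  exponent is \<open>1\<close> at \<open>j\<close> and \<open>0\<close> elsewhere; this exponent is reduced because two different roots of
  unity force \<open>N j > 1\<close>.\<close>

lemma sum_X_exponents:
  assumes \<eta>: "\<eta> \<in> \<D>" and \<zeta>: "\<zeta> \<in> \<D>" and neq: "\<eta> \<noteq> \<zeta>"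
  shows "(\<Sum>\<alpha>\<in>carrier L. X \<alpha> \<eta> * cnj (X \<alpha> \<zeta>)) = 0"
proof -
  obtain j where j: "j \<in> {1..m}" "\<eta> j \<noteq> \<zeta> j"
    using PiE_ext [OF \<eta>[unfolded full_design_def] \<zeta>[unfolded full_design_def]] neq by blast
  define \<alpha> :: "nat \<Rightarrow> int" where "\<alpha> = (\<lambda>i\<in>{1..m}. if i = j then 1 else 0)"
  have "N j \<noteq> 1"
    using j(2) design_coordinate(1) [OF \<eta> j(1)] design_coordinate(1) [OF \<zeta> j(1)] by auto
  then have \<alpha>: "\<alpha> \<in> carrier L"
    by (auto simp: exponent_group_def \<alpha>_def)
  have X_\<alpha>: "X \<alpha> \<xi> = \<xi> j" for \<xi>
  proof -
    have "X \<alpha> \<xi> = (\<Prod>i=1..m. if i = j then \<xi> j else 1)"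
      unfolding term_fun_def by (rule prod.cong) (auto simp: \<alpha>_def)
    then show ?thesis
      using j(1) by simp
  qed
  have "X \<alpha> \<eta> * cnj (X \<alpha> \<zeta>) \<noteq> 1"
    using j(2) norm_X [OF \<zeta>, of \<alpha>] by (simp add: unimodular_mult_cnj_eq_1_iff X_\<alpha>)
  then show ?thesis
    using L.sum_nontrivial_character [of "\<lambda>\<alpha>. X \<alpha> \<eta> * cnj (X \<alpha> \<zeta>)" \<alpha>] \<alpha>
    by (simp add: X_mult \<eta> \<zeta> mult_ac)
qed

section \<open>Regularity and the form of the indicator function\<close>

text \<open>The subgroup is that of all terms constant on the fraction, which contains \<open>A\<close>; adding its
  equations to those of \<open>A\<close> loses no point of the fraction.\<close>

lemma regular_fraction_if_equations:
  assumes "\<F> \<noteq> {}" "A \<subseteq> carrier L" and F: "\<F> = {\<zeta> \<in> \<D>. \<forall>\<alpha>\<in>A. X \<alpha> \<zeta> = e \<alpha>}"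
  shows "regular_fraction m N \<F>"
proof -
  obtain \<eta> where \<eta>: "\<eta> \<in> \<F>"
    using \<open>\<F> \<noteq> {}\<close> by blast
  have sub: "\<F> \<subseteq> \<D>"
    using F by blast
  \<comment> \<open>The constant value of a term is read off at the base point \<open>\<eta>\<close>.\<close>
  define M where "M = {\<alpha> \<in> carrier L. \<forall>\<zeta>\<in>\<F>. X \<alpha> \<zeta> = X \<alpha> \<eta>}"
  have M_carrier: "\<alpha> \<in> carrier L" and M_const: "\<zeta> \<in> \<F> \<Longrightarrow> X \<alpha> \<zeta> = X \<alpha> \<eta>"
    if "\<alpha> \<in> M" for \<alpha> \<zeta>
    using that unfolding M_def by blast+
  have M_I: "\<alpha> \<in> M" if "\<alpha> \<in> carrier L" "\<And>\<zeta>. \<zeta> \<in> \<F> \<Longrightarrow> X \<alpha> \<zeta> = X \<alpha> \<eta>" for \<alpha>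
    using that unfolding M_def by blast
  have "subgroup M L"
  proof (rule L.subgroupI)
    show "M \<subseteq> carrier L"
      using M_carrier by blast
    show "M \<noteq> {}"
      using M_I [OF L.one_closed] X_one by auto
    show "inv\<^bsub>L\<^esub> \<alpha> \<in> M" if "\<alpha> \<in> M" for \<alpha>
    proof (rule M_I)
      have X_inv: "X (inv\<^bsub>L\<^esub> \<alpha>) \<zeta> = cnj (X \<alpha> \<zeta>)" if "\<zeta> \<in> \<F>" for \<zeta>
        using X_diff [of \<zeta> "\<one>\<^bsub>L\<^esub>" \<alpha>] M_carrier [OF \<open>\<alpha> \<in> M\<close>] that sub by (auto simp: X_one)
      show "X (inv\<^bsub>L\<^esub> \<alpha>) \<zeta> = X (inv\<^bsub>L\<^esub> \<alpha>) \<eta>" if "\<zeta> \<in> \<F>" for \<zeta>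
        by (simp only: X_inv [OF that] X_inv [OF \<eta>] M_const [OF \<open>\<alpha> \<in> M\<close> that])
    qed (use M_carrier [OF that] in simp)
    show "\<alpha> \<otimes>\<^bsub>L\<^esub> \<beta> \<in> M" if "\<alpha> \<in> M" "\<beta> \<in> M" for \<alpha> \<beta>
    proof (rule M_I)
      show "X (\<alpha> \<otimes>\<^bsub>L\<^esub> \<beta>) \<zeta> = X (\<alpha> \<otimes>\<^bsub>L\<^esub> \<beta>) \<eta>" if "\<zeta> \<in> \<F>" for \<zeta>
        using that \<eta> sub
        by (simp only: X_mult subsetD M_const [OF \<open>\<alpha> \<in> M\<close> that] M_const [OF \<open>\<beta> \<in> M\<close> that])
    qed (use M_carrier that in simp)
  qed
  moreover have "(\<lambda>\<alpha>. X \<alpha> \<eta>) \<in> hom (L\<lparr>carrier := M\<rparr>) (unity_roots (level_lcm m N))"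
    using \<eta> sub by (auto simp: hom_def unity_roots_def X_unity_root X_mult)
  moreover have "\<F> = {\<zeta> \<in> \<D>. \<forall>\<alpha>\<in>M. X \<alpha> \<zeta> = X \<alpha> \<eta>}"
  proof
    show "\<F> \<subseteq> {\<zeta> \<in> \<D>. \<forall>\<alpha>\<in>M. X \<alpha> \<zeta> = X \<alpha> \<eta>}"
      using sub M_const by blast
    have "A \<subseteq> M"
    proof
      show "\<alpha> \<in> M" if "\<alpha> \<in> A" for \<alpha>
        using that assms(2) \<eta> F by (intro M_I) auto
    qed
    moreover have "\<forall>\<alpha>\<in>A. X \<alpha> \<eta> = e \<alpha>"
      using F \<eta> by blast
    ultimately show "{\<zeta> \<in> \<D>. \<forall>\<alpha>\<in>M. X \<alpha> \<zeta> = X \<alpha> \<eta>} \<subseteq> \<F>"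
      using F by auto
  qed
  ultimately show ?thesis
    unfolding regular_fraction_def by blast
qed

lemma norm_unity_root: "z \<in> carrier (unity_roots (level_lcm m N)) \<Longrightarrow> cmod z = 1"
  using power_eq_1_iff [of z "level_lcm m N"] level_lcm_pos by (auto simp: unity_roots_def)

lemma regular_fraction_if_indicator:
  assumes "\<F> \<noteq> {}" "\<F> \<subseteq> \<D>" and A: "A \<subseteq> carrier L" "A \<noteq> {}"
    and e: "e \<in> A \<rightarrow> carrier (unity_roots (level_lcm m N))"
    and indicator: "\<And>\<zeta>. \<zeta> \<in> \<D> \<Longrightarrow>
      indicator \<F> \<zeta> = 1 / of_nat (card A) * (\<Sum>\<alpha>\<in>A. cnj (e \<alpha>) * X \<alpha> \<zeta>)"
  shows "regular_fraction m N \<F>"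
proof (rule regular_fraction_if_equations [OF assms(1) A(1)])
  have finite: "finite A"
    using A(1) finite_L by (rule finite_subset)
  then have card: "card A \<noteq> 0"
    using A(2) by simp
  have norm_e: "cmod (e \<alpha>) = 1" if "\<alpha> \<in> A" for \<alpha>
    using that e norm_unity_root by blast
  have "\<zeta> \<in> \<F> \<longleftrightarrow> (\<forall>\<alpha>\<in>A. X \<alpha> \<zeta> = e \<alpha>)" if "\<zeta> \<in> \<D>" for \<zeta>
  proof
    assume "\<zeta> \<in> \<F>"
    then have sum: "(\<Sum>\<alpha>\<in>A. cnj (e \<alpha>) * X \<alpha> \<zeta>) = of_nat (card A)"
      using indicator [OF that] card by (simp add: field_simps)
    show "\<forall>\<alpha>\<in>A. X \<alpha> \<zeta> = e \<alpha>"
    proof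
      fix \<alpha> assume "\<alpha> \<in> A"
      then have "cnj (e \<alpha>) * X \<alpha> \<zeta> = 1"
        using sum_unimodular_eq_card_imp_eq_1 [OF finite _ sum] norm_e norm_X [OF that]
        by (simp add: norm_mult)
      then show "X \<alpha> \<zeta> = e \<alpha>"
        by (simp only: unimodular_mult_cnj_eq_1_iff norm_e [OF \<open>\<alpha> \<in> A\<close>])
    qed
  next
    assume "\<forall>\<alpha>\<in>A. X \<alpha> \<zeta> = e \<alpha>"
    then have "cnj (e \<alpha>) * X \<alpha> \<zeta> = 1" if "\<alpha> \<in> A" for \<alpha>
      using that by (simp add: unimodular_mult_cnj_eq_1_iff norm_e)
    then have "indicator \<F> \<zeta> = (1 :: complex)"
      using indicator [OF that] card by simp
    then show "\<zeta> \<in> \<F>"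
      by (simp add: indicator_def split: if_splits)
  qed
  then show "\<F> = {\<zeta> \<in> \<D>. \<forall>\<alpha>\<in>A. X \<alpha> \<zeta> = e \<alpha>}"
    using assms(2) by blast
qed

text \<open>At a point \<open>\<zeta>\<close> of the design, the summands are the values of a character of \<open>\<L>\<close>, which is
  trivial exactly when \<open>\<zeta>\<close> satisfies the defining equations.\<close>

lemma indicator_if_subgroup_equations:
  assumes sub: "subgroup \<L> L"
    and hom: "e \<in> hom (L\<lparr>carrier := \<L>\<rparr>) (unity_roots (level_lcm m N))"
    and \<zeta>: "\<zeta> \<in> \<D>"
  shows "indicator {\<zeta> \<in> \<D>. \<forall>\<alpha>\<in>\<L>. X \<alpha> \<zeta> = e \<alpha>} \<zeta> =
    1 / of_nat (card \<L>) * (\<Sum>\<alpha>\<in>\<L>. cnj (e \<alpha>) * X \<alpha> \<zeta>)"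
proof -
  interpret S: group "L\<lparr>carrier := \<L>\<rparr>"
    using sub group_L by (rule subgroup.subgroup_is_group)
  have "finite \<L>"
    using subgroup.subset [OF sub] finite_L by (rule finite_subset)
  then have card: "card \<L> \<noteq> 0"
    using subgroup.one_closed [OF sub] by auto
  have trivial_iff: "cnj (e \<alpha>) * X \<alpha> \<zeta> = 1 \<longleftrightarrow> X \<alpha> \<zeta> = e \<alpha>" if "\<alpha> \<in> \<L>" for \<alpha>
  proof -
    have "e \<alpha> \<in> carrier (unity_roots (level_lcm m N))"
      using hom that by (auto simp: hom_def)
    then show ?thesis
      by (simp add: unimodular_mult_cnj_eq_1_iff norm_unity_root)
  qed
  show ?thesis
  proof (cases "\<forall>\<alpha>\<in>\<L>. X \<alpha> \<zeta> = e \<alpha>")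
    case True
    then have "(\<Sum>\<alpha>\<in>\<L>. cnj (e \<alpha>) * X \<alpha> \<zeta>) = of_nat (card \<L>)"
      using trivial_iff by simp
    then show ?thesis
      using True \<zeta> card by simp
  next
    case False
    then obtain \<beta> where \<beta>: "\<beta> \<in> \<L>" "X \<beta> \<zeta> \<noteq> e \<beta>"
      by blast
    have "e (\<alpha> \<otimes>\<^bsub>L\<^esub> \<beta>) = e \<alpha> * e \<beta>" if "\<alpha> \<in> \<L>" "\<beta> \<in> \<L>" for \<alpha> \<beta>
      using hom that by (auto simp: hom_def unity_roots_def)
    then have "(\<Sum>\<alpha>\<in>\<L>. cnj (e \<alpha>) * X \<alpha> \<zeta>) = 0"
      using S.sum_nontrivial_character [of "\<lambda>\<alpha>. cnj (e \<alpha>) * X \<alpha> \<zeta>" \<beta>] \<beta> trivial_iff [of \<beta>]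
      by (simp add: X_mult \<zeta> mult_ac)
    then show ?thesis
      using False by (simp add: indicator_def)
  qed
qed

section \<open>Regularity and confounding\<close>

text \<open>Both alternatives concern the single term \<open>X\<^sup>\<gamma> = X\<^sup>\<alpha> cnj (X\<^sup>\<beta>)\<close>: either \<open>\<gamma> \<in> \<L>\<close> and it is
  constant, or it is orthogonal over the whole design to every term in the expansion of the
  indicator function.\<close>

lemma orthogonal_or_confounded_if_subgroup_equations:
  assumes sub: "subgroup \<L> L"
    and hom: "e \<in> hom (L\<lparr>carrier := \<L>\<rparr>) (unity_roots (level_lcm m N))"
    and F: "\<F> = {\<zeta> \<in> \<D>. \<forall>\<alpha>\<in>\<L>. X \<alpha> \<zeta> = e \<alpha>}"
    and \<alpha>: "\<alpha> \<in> carrier L" and \<beta>: "\<beta> \<in> carrier L"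
  shows "orthogonal_on m \<F> \<alpha> \<beta> \<or> totally_confounded_on m \<F> \<alpha> \<beta>"
proof -
  define \<gamma> where "\<gamma> = \<alpha> \<otimes>\<^bsub>L\<^esub> inv\<^bsub>L\<^esub> \<beta>"
  have X_\<gamma>: "X \<gamma> \<zeta> = X \<alpha> \<zeta> * cnj (X \<beta> \<zeta>)" if "\<zeta> \<in> \<D>" for \<zeta>
    using X_diff [OF that \<alpha> \<beta>] by (simp add: \<gamma>_def)
  have \<gamma>: "\<gamma> \<in> carrier L"
    using \<alpha> \<beta> by (simp add: \<gamma>_def)
  show ?thesis
  proof (cases "\<gamma> \<in> \<L>")
    case True
    have "X \<alpha> \<zeta> = e \<gamma> * X \<beta> \<zeta>" if "\<zeta> \<in> \<F>" for \<zeta>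
    proof -
      have "\<zeta> \<in> \<D>" "e \<gamma> = X \<gamma> \<zeta>"
        using that True by (auto simp: F)
      then show ?thesis
        using X_\<gamma> unimodular_mult_cnj_eq_1_iff(2) [OF norm_X, of \<zeta> \<beta> "X \<beta> \<zeta>"]
        by (simp add: mult.assoc)
    qed
    then show ?thesis
      by (auto simp: totally_confounded_on_def)
  next
    case False
    have zero: "(\<Sum>\<zeta>\<in>\<D>. X \<delta> \<zeta> * X \<gamma> \<zeta>) = 0" if "\<delta> \<in> \<L>" for \<delta>
    proof -
      have "\<delta> \<in> carrier L"
        using subgroup.subset [OF sub] that by blast
      moreover have "\<delta> \<otimes>\<^bsub>L\<^esub> \<gamma> \<noteq> \<one>\<^bsub>L\<^esub>"
      proof
        assume "\<delta> \<otimes>\<^bsub>L\<^esub> \<gamma> = \<one>\<^bsub>L\<^esub>"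
        then have "\<gamma> = inv\<^bsub>L\<^esub> \<delta>"
          using \<gamma> \<open>\<delta> \<in> carrier L\<close> L.inv_equality L.inv_inv by metis
        then show False
          using False subgroup.m_inv_closed [OF sub that] by simp
      qed
      ultimately have "(\<Sum>\<zeta>\<in>\<D>. X (\<delta> \<otimes>\<^bsub>L\<^esub> \<gamma>) \<zeta>) = 0"
        using \<gamma> by (intro sum_X_design) auto
      then show ?thesis
        by (simp add: X_mult)
    qed
    have "(\<Sum>\<zeta>\<in>\<F>. X \<alpha> \<zeta> * cnj (X \<beta> \<zeta>)) = (\<Sum>\<zeta>\<in>\<D>. indicator \<F> \<zeta> * X \<gamma> \<zeta>)"
      using finite_design by (auto simp: F X_\<gamma> indicator_def intro!: sum.mono_neutral_cong_left)
    also have "\<dots> = (\<Sum>\<zeta>\<in>\<D>. \<Sum>\<delta>\<in>\<L>. 1 / of_nat (card \<L>) * cnj (e \<delta>) * (X \<delta> \<zeta> * X \<gamma> \<zeta>))"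
      unfolding F
      by (intro sum.cong refl)
        (simp only: indicator_if_subgroup_equations [OF sub hom] sum_distrib_left
          sum_distrib_right mult.assoc)
    also have "\<dots> = (\<Sum>\<delta>\<in>\<L>. 1 / of_nat (card \<L>) * cnj (e \<delta>) * (\<Sum>\<zeta>\<in>\<D>. X \<delta> \<zeta> * X \<gamma> \<zeta>))"
      unfolding sum_distrib_left by (rule sum.swap)
    also have "\<dots> = 0"
      by (simp add: zero)
    finally show ?thesis
      by (simp add: orthogonal_on_def)
  qed
qed

text \<open>Being confounded with \<open>X\<^sup>0 = 1\<close> means being constant, and being orthogonal to it means summing
  to zero.  Let \<open>\<zeta>\<close> satisfy the equations of all terms constant on the fraction, and sum
  \<open>X\<^sup>\<alpha>(\<eta>) cnj (X\<^sup>\<alpha>(\<zeta>))\<close> over all \<open>\<alpha>\<close> and all points \<open>\<eta>\<close> of the fraction.  Summing over \<open>\<eta>\<close>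
  first counts each constant term, among them \<open>X\<^sup>0\<close>, once for every \<open>\<eta>\<close>; summing over \<open>\<alpha>\<close> first
  gives zero unless \<open>\<zeta>\<close> is one of the \<open>\<eta>\<close>.\<close>

lemma regular_fraction_if_orthogonal_or_confounded:
  assumes "\<F> \<noteq> {}" and sub: "\<F> \<subseteq> \<D>"
    and dichotomy: "\<And>\<alpha>. \<alpha> \<in> carrier L \<Longrightarrow>
      orthogonal_on m \<F> \<alpha> \<one>\<^bsub>L\<^esub> \<or> totally_confounded_on m \<F> \<alpha> \<one>\<^bsub>L\<^esub>"
  shows "regular_fraction m N \<F>"
proof -
  obtain \<eta>\<^sub>0 where \<eta>\<^sub>0: "\<eta>\<^sub>0 \<in> \<F>"
    using \<open>\<F> \<noteq> {}\<close> by blast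
  define M where "M = {\<alpha> \<in> carrier L. \<forall>\<eta>\<in>\<F>. X \<alpha> \<eta> = X \<alpha> \<eta>\<^sub>0}"
  have finite: "finite \<F>" "finite M"
    using sub finite_design finite_L by (auto simp: M_def intro: finite_subset)
  have card: "card \<F> \<noteq> 0" "card M \<noteq> 0"
    using finite \<open>\<F> \<noteq> {}\<close> X_one by (auto simp: M_def)
  have sum_0: "(\<Sum>\<eta>\<in>\<F>. X \<alpha> \<eta>) = 0" if "\<alpha> \<in> carrier L - M" for \<alpha>
  proof -
    have "\<not> totally_confounded_on m \<F> \<alpha> \<one>\<^bsub>L\<^esub>"
      using that \<eta>\<^sub>0 unfolding totally_confounded_on_def M_def X_one by fastforce
    then have "orthogonal_on m \<F> \<alpha> \<one>\<^bsub>L\<^esub>"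
      using dichotomy that by blast
    then show ?thesis
      using card by (simp add: orthogonal_on_def X_one)
  qed
  have "\<zeta> \<in> \<F>" if "\<zeta> \<in> \<D>" and eq: "\<forall>\<alpha>\<in>M. X \<alpha> \<zeta> = X \<alpha> \<eta>\<^sub>0" for \<zeta>
  proof (rule ccontr)
    assume "\<zeta> \<notin> \<F>"
    \<comment> \<open>Only the constant terms, where every summand is \<open>1\<close>, contribute to the sum over all \<open>\<alpha>\<close>.\<close>
    have "of_nat (card M * card \<F>) = (\<Sum>\<alpha>\<in>M. \<Sum>\<eta>\<in>\<F>. X \<alpha> \<eta> * cnj (X \<alpha> \<zeta>))"
    proof -
      have "X \<alpha> \<eta> = X \<alpha> \<zeta>" if "\<alpha> \<in> M" "\<eta> \<in> \<F>" for \<alpha> \<eta>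
        using that eq M_def by fastforce
      then have "X \<alpha> \<eta> * cnj (X \<alpha> \<zeta>) = 1" if "\<alpha> \<in> M" "\<eta> \<in> \<F>" for \<alpha> \<eta>
        using that norm_X [OF \<open>\<zeta> \<in> \<D>\<close>] by (simp only: unimodular_mult_cnj_eq_1_iff)
      then show ?thesis
        by simp
    qed
    also have "\<dots> = (\<Sum>\<alpha>\<in>carrier L. \<Sum>\<eta>\<in>\<F>. X \<alpha> \<eta> * cnj (X \<alpha> \<zeta>))"
      by (rule sum.mono_neutral_left)
        (use finite_L sum_0 in \<open>auto simp: M_def simp flip: sum_distrib_right\<close>)
    also have "\<dots> = (\<Sum>\<eta>\<in>\<F>. \<Sum>\<alpha>\<in>carrier L. X \<alpha> \<eta> * cnj (X \<alpha> \<zeta>))"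
      by (rule sum.swap)
    also have "\<dots> = 0"
      using sub \<open>\<zeta> \<in> \<D>\<close> \<open>\<zeta> \<notin> \<F>\<close> by (intro sum.neutral ballI sum_X_exponents) auto
    finally show False
      using card by simp
  qed
  then have "\<F> = {\<zeta> \<in> \<D>. \<forall>\<alpha>\<in>M. X \<alpha> \<zeta> = X \<alpha> \<eta>\<^sub>0}"
    using sub by (auto simp: M_def)
  moreover have "M \<subseteq> carrier L"
    unfolding M_def by blast
  ultimately show ?thesis
    by (intro regular_fraction_if_equations [OF \<open>\<F> \<noteq> {}\<close>, of M "\<lambda>\<alpha>. X \<alpha> \<eta>\<^sub>0"])
qed

end

section \<open>Equivalence of the three conditions\<close>

theorem proposition5:
  fixes m :: nat and N :: "nat \<Rightarrow> nat" and \<F> :: "(nat \<Rightarrow> complex) set"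
  assumes "m \<ge> 1"
    and "\<And>j. j \<in> {1..m} \<Longrightarrow> N j > 0"
    and "\<F> \<subseteq> full_design m N"
    and "\<F> \<noteq> {}"
  shows
    "(regular_fraction m N \<F> \<longleftrightarrow>
       (\<exists>\<L> e. \<L> \<subseteq> carrier (exponent_group m N) \<and>
              \<one>\<^bsub>exponent_group m N\<^esub> \<in> \<L> \<and>
              e \<in> \<L> \<rightarrow> carrier (unity_roots (level_lcm m N)) \<and>
              (\<forall>\<zeta>\<in>full_design m N.
                 indicator \<F> \<zeta> =
                   1 / of_nat (card \<L>) * (\<Sum>\<alpha>\<in>\<L>. cnj (e \<alpha>) * term_fun m \<alpha> \<zeta>)))) \<and>
     (regular_fraction m N \<F> \<longleftrightarrow>
       (\<forall>\<alpha>\<in>carrier (exponent_group m N). \<forall>\<beta>\<in>carrier (exponent_group m N).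
          orthogonal_on m \<F> \<alpha> \<beta> \<or> totally_confounded_on m \<F> \<alpha> \<beta>))"
    (is "(_ \<longleftrightarrow> ?indicator) \<and> (_ \<longleftrightarrow> ?dichotomy)")
proof -
  interpret factorial_design m N
    using assms(2) by unfold_locales
  have "?indicator" if regular: "regular_fraction m N \<F>"
  proof -
    obtain \<L> e where sub: "subgroup \<L> L"
      and hom: "e \<in> hom (L\<lparr>carrier := \<L>\<rparr>) (unity_roots (level_lcm m N))"
      and F: "\<F> = {\<zeta> \<in> \<D>. \<forall>\<alpha>\<in>\<L>. X \<alpha> \<zeta> = e \<alpha>}"
      using regular unfolding regular_fraction_def by blast
    have "e \<in> \<L> \<rightarrow> carrier (unity_roots (level_lcm m N))"
      using hom by (auto simp: hom_def)
    with indicator_if_subgroup_equations [OF sub hom] show ?thesis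
      using subgroup.subset [OF sub] subgroup.one_closed [OF sub] unfolding F by blast
  qed
  moreover have "regular_fraction m N \<F>" if "?indicator"
    using that regular_fraction_if_indicator [OF assms(4) assms(3)] by blast
  moreover have "?dichotomy" if "regular_fraction m N \<F>"
    using that orthogonal_or_confounded_if_subgroup_equations
    unfolding regular_fraction_def by blast
  moreover have "regular_fraction m N \<F>" if "?dichotomy"
    using that regular_fraction_if_orthogonal_or_confounded [OF assms(4) assms(3)] by simp
  ultimately show ?thesis
    by blast
qed

end
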